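(* Let $n,m\ge 1$, $b\in\mathbb{R}^m$, $f:\mathbb{R}^n\to\mathbb{R}^m$, $r\in\mathbb{R}\setminus\{0\}$, $\beta>0$, $\vartheta_1,\dots,\vartheta_n>0$, and let $\mathsf{D}_\vartheta$ be the $n\times n$ diagonal matrix with diagonal $(\vartheta_1,\dots,\vartheta_n)$. Consider the (scaled) posterior density on $\mathbb{R}^n\times(0,\infty)^n$, $$\pi_{\Xi,\Lambda\mid B}(\xi,\lambda\mid b)\propto \exp\Big(-\tfrac12\big\|b-f(\mathsf{D}_\vartheta^{1/2}\xi)\big\|^2-\tfrac12\sum_{j=1}^n\frac{\xi_j^2}{\lambda_j}-\sum_{j=1}^n\lambda_j^r+\big(r\beta-\tfrac32\big)\sum_{j=1}^n\log\lambda_j\Big),$$ and the change of variables, for $1\le j\le n$, $$\lambda_j=\Big(\frac{\tau_j^2}{2}\Big)^{1/r},\qquad \xi_j=v_j\sqrt{\lambda_j}=\frac{v_j|\tau_j|^{1/r}}{2^{1/(2r)}},\qquad v_j\in\mathbb{R},\ \tau_j\in\mathbb{R}\setminus\{0\}.$$ Let $J(v_j,\tau_j)=\det\frac{\partial(\lambda_j,\xi_j)}{\partial(\tau_j,v_j)}$ be the corresponding Jacobian determinant, and let $$\pi_{V,T}(v,\tau\mid b)=\Big(\prod_{j=1}^n|J(v_j,\tau_j)|\Big)\,\pi_{\Xi,\Lambda\mid B}\big(\xi(v,\tau),\lambda(v,\tau)\mid b\big)$$ be the posterior density written in the new variables. Then $$\pi_{V,T}(v,\tau\mid b)\propto e^{-\Phi(v,\tau)}\,\mathcal{N}\big((v,\tau)\mid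 0,\mathsf{I}_{2n}\big),$$ where $$\Phi(v,\tau)=\frac12\Big\|b-f\Big(\frac{1}{2^{1/(2r)}}\mathsf{D}_\vartheta^{1/2}\big(v|\tau|^{1/r}\big)\Big)\Big\|^2-(2\beta-1)\sum_{j=1}^n\log|\tau_j| .$$
   Context: $\|\cdot\|$ is the Euclidean norm. The symbol $\propto$ means equality up to a positive multiplicative constant independent of the variables $(\xi,\lambda)$, respectively $(v,\tau)$. $\mathcal{N}(\,\cdot\mid 0,\mathsf{I}_{2n})$ denotes the density of the standard normal distribution on $\mathbb{R}^{2n}$, and $\mathsf{I}_{2n}$ the $2n\times 2n$ identity matrix. Products and powers of vectors are component-wise: $(v|\tau|^{1/r})_j=v_j|\tau_j|^{1/r}$, $1\le j\le n$. *)

theory Defs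
  imports "HOL-Analysis.Analysis"
begin

definition proportional_on :: "'a set \<Rightarrow> ('a \<Rightarrow> real) \<Rightarrow> ('a \<Rightarrow> real) \<Rightarrow> bool" where
  "proportional_on S p q \<longleftrightarrow> (\<exists>c>0. \<forall>x\<in>S. p x = c * q x)"

definition diag_matrix :: "real^'n \<Rightarrow> real^'n^'n" where
  "diag_matrix d = (\<chi> i j. if i = j then d $ i else 0)"

definition diag_sqrt :: "real^'n \<Rightarrow> real^'n^'n" where
  "diag_sqrt \<theta> = diag_matrix (\<chi> j. sqrt (\<theta> $ j))"

lemma diag_sqrt_square:
  fixes \<theta> :: "real^'n"
  assumes "\<And>j. \<theta> $ j > 0"
  shows "diag_sqrt \<theta> ** diag_sqrt \<theta> = diag_matrix \<theta>"
proof -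
  have entry: "diag_sqrt \<theta> $ i $ k * diag_sqrt \<theta> $ k $ j
      = (if k = i then (if i = j then \<theta> $ i else 0) else 0)" for i j k
    using assms[of i] by (auto simp: diag_sqrt_def diag_matrix_def)
  show ?thesis
    by (simp add: vec_eq_iff matrix_matrix_mult_def entry) (simp add: diag_matrix_def)
qed

text \<open>\<open>C\<close> is meant to be positive definite; otherwise the value is meaningless.\<close>

definition multivariate_normal_density :: "real^'k \<Rightarrow> real^'k^'k \<Rightarrow> real^'k \<Rightarrow> real" where
  "multivariate_normal_density \<mu> C x =
     exp (- (1/2) * ((x - \<mu>) \<bullet> (matrix_inv C *v (x - \<mu>)))) / sqrt ((2 * pi) ^ CARD('k) * det C)"

text \<open>\<open>\<real>\<^sup>2\<^sup>n\<close> is rendered as \<^typ>\<open>real^('n + 'n)\<close>.\<close>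

definition vec_concat :: "real^'n \<Rightarrow> real^'m \<Rightarrow> real^('n + 'm)" where
  "vec_concat v t = (\<chi> k. case k of Inl i \<Rightarrow> v $ i | Inr j \<Rightarrow> t $ j)"

definition posterior_kernel ::
  "(real^'n \<Rightarrow> real^'m) \<Rightarrow> real^'m \<Rightarrow> real^'n \<Rightarrow> real \<Rightarrow> real \<Rightarrow> (real^'n) \<times> (real^'n) \<Rightarrow> real" where
  "posterior_kernel f b \<theta> r \<beta> = (\<lambda>(\<xi>, l).
     exp (- (1/2) * (norm (b - f (diag_sqrt \<theta> *v \<xi>)))\<^sup>2
          - (1/2) * (\<Sum>j\<in>UNIV. (\<xi> $ j)\<^sup>2 / l $ j)
          - (\<Sum>j\<in>UNIV. (l $ j) powr r)
          + (r * \<beta> - 3/2) * (\<Sum>j\<in>UNIV. ln (l $ j))))"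

definition lambda_of :: "real \<Rightarrow> real \<Rightarrow> real" where
  "lambda_of r t = (t\<^sup>2 / 2) powr (1 / r)"

definition xi_of :: "real \<Rightarrow> real \<Rightarrow> real \<Rightarrow> real" where
  "xi_of r v t = v * sqrt (lambda_of r t)"

text \<open>\<open>\<partial>(\<lambda>\<^sub>j, \<xi>\<^sub>j) / \<partial>(\<tau>\<^sub>j, v\<^sub>j)\<close>: in \<open>real^2\<close> the first coordinate of the argument is \<open>\<tau>\<^sub>j\<close>, the second is \<open>v\<^sub>j\<close>.\<close>

definition change_of_vars_det :: "real \<Rightarrow> real \<Rightarrow> real \<Rightarrow> real" where
  "change_of_vars_det r v t =
     det (jacobian (\<lambda>z::real^2. vector [lambda_of r (z $ 1), xi_of r (z $ 2) (z $ 1)] :: real^2)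
                   (at (vector [t, v])))"

definition transformed_density ::
  "real \<Rightarrow> ((real^'n) \<times> (real^'n) \<Rightarrow> real) \<Rightarrow> (real^'n) \<times> (real^'n) \<Rightarrow> real" where
  "transformed_density r p = (\<lambda>(v, t).
     (\<Prod>j\<in>UNIV. \<bar>change_of_vars_det r (v $ j) (t $ j)\<bar>)
       * p (\<chi> j. xi_of r (v $ j) (t $ j), \<chi> j. lambda_of r (t $ j)))"

definition vec_abs_powr_mult :: "real^'n \<Rightarrow> real^'n \<Rightarrow> real \<Rightarrow> real^'n" where
  "vec_abs_powr_mult v t a = (\<chi> j. v $ j * \<bar>t $ j\<bar> powr a)"

definition potential ::
  "(real^'n \<Rightarrow> real^'m) \<Rightarrow> real^'m \<Rightarrow> real^'n \<Rightarrow> real \<Rightarrow> real \<Rightarrow> (real^'n) \<times> (real^'n) \<Rightarrow> real" where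
  "potential f b \<theta> r \<beta> = (\<lambda>(v, t).
     (1/2) * (norm (b - f ((1 / 2 powr (1 / (2 * r))) *\<^sub>R
                 (diag_sqrt \<theta> *v vec_abs_powr_mult v t (1 / r)))))\<^sup>2
       - (2 * \<beta> - 1) * (\<Sum>j\<in>UNIV. ln \<bar>t $ j\<bar>))"

end

theory Submission
  imports Defs
begin

text \<open>
  The likelihood involves \<open>\<xi>\<close> only through \<open>f\<close> and is merely rewritten in the new variables;
  prior and Jacobian are products over the coordinates, so the rest is a computation in one
  coordinate.  For \<open>t \<noteq> 0\<close> the substitution
  \<open>\<lambda> = (t\<^sup>2/2)\<^bsup>1/r\<^esup>\<close>, \<open>\<xi> = v \<surd>\<lambda>\<close> is triangular, because \<open>\<lambda>\<close> does not depend on \<open>v\<close>; its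
  Jacobian determinant is therefore the product of \<open>\<partial>\<lambda>/\<partial>t = 2 \<lambda> / (r t)\<close> and
  \<open>\<partial>\<xi>/\<partial>v = \<surd>\<lambda>\<close>, that is \<open>2 \<lambda>\<^bsup>3/2\<^esup> / (r t)\<close> (\<open>change_of_vars_det_eq\<close>).

  The exponents of the prior are matched to this.  The quadratic term \<open>\<xi>\<^sup>2/\<lambda>\<close> becomes \<open>v\<^sup>2\<close>
  and \<open>\<lambda>\<^sup>r\<close> becomes \<open>t\<^sup>2/2\<close>, which together give a standard Gaussian in \<open>(v, t)\<close>.  The factor
  \<open>\<lambda>\<^bsup>3/2\<^esup>\<close> of the Jacobian cancels the \<open>-3/2\<close> in the power \<open>\<lambda>\<^bsup>r \<beta> - 3/2\<^esup>\<close>, and what remains,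
  \<open>\<lambda>\<^bsup>r \<beta>\<^esup> / |t| = 2\<^bsup>-\<beta>\<^esup> |t|\<^bsup>2 \<beta> - 1\<^esup>\<close>, is the logarithmic term of the potential up to a
  constant (\<open>log_weight_eq\<close>).  Each coordinate thus contributes the constant
  \<open>2\<^bsup>1-\<beta>\<^esup> / |r|\<close>; the remaining constants are that of the posterior and the
  normalisation of the Gaussian.
\<close>

lemma lambda_of_pos: "t \<noteq> 0 \<Longrightarrow> lambda_of r t > 0"
  by (simp add: lambda_of_def)

lemma ln_lambda_of:
  assumes "t \<noteq> 0"
  shows "ln (lambda_of r t) = (2 * ln \<bar>t\<bar> - ln 2) / r"
proof -
  have "ln (t\<^sup>2) = 2 * ln \<bar>t\<bar>"
    using assms ln_realpow[of "\<bar>t\<bar>" 2] by simp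
  then show ?thesis
    using assms by (simp add: lambda_of_def ln_powr ln_div)
qed

lemma lambda_of_powr:
  assumes "r \<noteq> 0" "t \<noteq> 0"
  shows "lambda_of r t powr r = t\<^sup>2 / 2"
  using assms by (simp add: lambda_of_def powr_powr)

lemma xi_of_square_div_lambda_of:
  assumes "t \<noteq> 0"
  shows "(xi_of r v t)\<^sup>2 / lambda_of r t = v\<^sup>2"
  using lambda_of_pos[OF assms, of r] by (simp add: xi_of_def power_mult_distrib)

lemma xi_of_eq:
  assumes "t \<noteq> 0"
  shows "xi_of r v t = v * \<bar>t\<bar> powr (1 / r) / 2 powr (1 / (2 * r))"
proof -
  have "sqrt (lambda_of r t) = lambda_of r t powr (1/2)"
    using lambda_of_pos[OF assms, of r] by (simp add: powr_half_sqrt)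
  also have "\<dots> = exp (ln (lambda_of r t) / 2)"
    using lambda_of_pos[OF assms, of r] by (simp add: powr_def)
  also have "\<dots> = exp (ln \<bar>t\<bar> / r - ln 2 / (2 * r))"
    by (simp add: ln_lambda_of[OF assms] diff_divide_distrib)
  also have "\<dots> = \<bar>t\<bar> powr (1 / r) / 2 powr (1 / (2 * r))"
    using assms by (simp add: powr_def exp_diff)
  finally show ?thesis by (simp add: xi_of_def)
qed

lemma lambda_of_has_derivative:
  assumes "r \<noteq> 0" "t \<noteq> 0"
  shows "(lambda_of r has_real_derivative 2 * lambda_of r t / (r * t)) (at t)"
proof -
  have "((\<lambda>t. (t\<^sup>2 / 2) powr (1 / r)) has_real_derivative
          (1 / r) * (t\<^sup>2 / 2) powr (1 / r - 1) * t) (at t)"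
    using assms by (auto intro!: derivative_eq_intros)
  moreover have "(1 / r) * (t\<^sup>2 / 2) powr (1 / r - 1) * t = 2 * lambda_of r t / (r * t)"
    using assms by (simp add: lambda_of_def powr_diff power2_eq_square)
  ultimately show ?thesis by (simp add: lambda_of_def[abs_def])
qed

lemma det_jacobian_triangular:
  fixes g :: "real \<Rightarrow> real" and h :: "real \<Rightarrow> real"
  assumes g: "(g has_real_derivative g') (at t)" and h: "(h has_real_derivative h') (at t)"
  shows "det (jacobian (\<lambda>z::real^2. vector [g (z $ 1), z $ 2 * h (z $ 1)] :: real^2)
            (at (vector [t, v]))) = g' * h t"
proof -
  let ?z = "vector [t, v] :: real^2"
  have vec: "(vector [x, y] :: real^2) = x *\<^sub>R axis 1 1 + y *\<^sub>R axis 2 1" for x y :: real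
    by (simp add: vec_eq_iff forall_2 axis_def)
  have nth: "((\<lambda>z::real^2. z $ i) has_derivative (\<lambda>z. z $ i)) (at ?z)" for i
    by (rule bounded_linear_imp_has_derivative[OF bounded_linear_vec_nth])
  have comp: "((\<lambda>z::real^2. k (z $ 1)) has_derivative (\<lambda>z. k' * z $ 1)) (at ?z)"
    if "(k has_real_derivative k') (at t)" for k k'
    using has_derivative_compose[OF nth[of 1], of k "\<lambda>x. k' * x"] that
    by (simp add: has_field_derivative_def)
  have second: "((\<lambda>z::real^2. z $ 2 * h (z $ 1)) has_derivative
      (\<lambda>z. v * (h' * z $ 1) + z $ 2 * h t)) (at ?z)"
    using has_derivative_mult[OF nth[of 2] comp[OF h]] by simp
  have "((\<lambda>z::real^2. vector [g (z $ 1), z $ 2 * h (z $ 1)] :: real^2) has_derivative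
      (\<lambda>z. vector [g' * z $ 1, v * (h' * z $ 1) + z $ 2 * h t])) (at ?z)"
    unfolding vec[of "g _"] vec[of "g' * _"]
    by (intro has_derivative_add has_derivative_scaleR_left comp[OF g] second)
  from frechet_derivative_at[OF this, symmetric] show ?thesis
    by (simp add: jacobian_def matrix_def det_2 axis_def)
qed

lemma change_of_vars_det_eq:
  assumes "r \<noteq> 0" "t \<noteq> 0"
  shows "change_of_vars_det r v t = 2 * lambda_of r t / (r * t) * sqrt (lambda_of r t)"
proof -
  have "((\<lambda>t. sqrt (lambda_of r t)) has_real_derivative
      inverse (sqrt (lambda_of r t)) / 2 * (2 * lambda_of r t / (r * t))) (at t)"
    by (rule DERIV_chain2[OF DERIV_real_sqrt lambda_of_has_derivative])
       (use assms lambda_of_pos in auto)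
  from det_jacobian_triangular[OF lambda_of_has_derivative[OF assms] this]
  show ?thesis by (simp add: change_of_vars_det_def xi_of_def)
qed

text \<open>
  The coordinatewise cancellation is linear once logarithms are taken: the two \<open>3/2\<close> terms
  in \<open>ln \<lambda>\<close> cancel, and \<open>r \<beta> ln \<lambda> = \<beta> (2 ln |t| - ln 2)\<close>.
\<close>

lemma log_weight_eq:
  assumes "r \<noteq> 0" "t \<noteq> 0"
  shows "\<bar>change_of_vars_det r v t\<bar> * exp ((r * \<beta> - 3/2) * ln (lambda_of r t))
    = 2 powr (1 - \<beta>) / \<bar>r\<bar> * exp ((2 * \<beta> - 1) * ln \<bar>t\<bar>)"
proof -
  let ?l = "lambda_of r t"
  have l: "?l > 0" using lambda_of_pos assms by simp
  have "\<bar>change_of_vars_det r v t\<bar> > 0"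
    using l assms by (simp add: change_of_vars_det_eq)
  moreover have "ln \<bar>change_of_vars_det r v t\<bar> = ln 2 - (ln \<bar>r\<bar>) - (ln \<bar>t\<bar>) + 3/2 * ln ?l"
    using l assms by (simp add: change_of_vars_det_eq abs_mult ln_mult ln_div ln_sqrt)
  ultimately have "\<bar>change_of_vars_det r v t\<bar> = exp (ln 2 - (ln \<bar>r\<bar>) - (ln \<bar>t\<bar>) + 3/2 * ln ?l)"
    by (metis exp_ln)
  then have "\<bar>change_of_vars_det r v t\<bar> * exp ((r * \<beta> - 3/2) * ln ?l)
      = exp (ln 2 - (ln \<bar>r\<bar>) - (ln \<bar>t\<bar>) + r * \<beta> * ln ?l)"
    by (simp add: algebra_simps flip: exp_add)
  also have "r * \<beta> * ln ?l = \<beta> * (2 * ln \<bar>t\<bar> - ln 2)"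
    using assms by (simp add: ln_lambda_of)
  also have "ln 2 - (ln \<bar>r\<bar>) - (ln \<bar>t\<bar>) + \<beta> * (2 * ln \<bar>t\<bar> - ln 2)
      = (1 - \<beta>) * ln 2 - (ln \<bar>r\<bar>) + (2 * \<beta> - 1) * ln \<bar>t\<bar>"
    by (simp add: algebra_simps)
  also have "exp \<dots> = 2 powr (1 - \<beta>) / \<bar>r\<bar> * exp ((2 * \<beta> - 1) * ln \<bar>t\<bar>)"
    using assms by (simp add: exp_add exp_diff powr_def)
  finally show ?thesis .
qed

lemma matrix_inv_mat_1: "matrix_inv (mat 1 :: real^'k^'k) = mat 1"
  by (simp add: matrix_inv_def)

lemma standard_normal_density_vec_concat:
  fixes v t :: "real^'n"
  shows "multivariate_normal_density 0 (mat 1) (vec_concat v t)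
    = exp (- (1/2) * (\<Sum>j\<in>UNIV. (v $ j)\<^sup>2) - (1/2) * (\<Sum>j\<in>UNIV. (t $ j)\<^sup>2))
      / sqrt ((2 * pi) ^ CARD('n + 'n))"
proof -
  have "vec_concat v t \<bullet> vec_concat v t = (\<Sum>j\<in>UNIV. (v $ j)\<^sup>2) + (\<Sum>j\<in>UNIV. (t $ j)\<^sup>2)"
    by (simp add: inner_vec_def vec_concat_def sum.Plus power2_eq_square flip: UNIV_Plus_UNIV)
  then show ?thesis
    by (simp add: multivariate_normal_density_def matrix_inv_mat_1 algebra_simps)
qed

lemma transformed_posterior_kernel:
  fixes f :: "real^'n \<Rightarrow> real^'m" and v t :: "real^'n"
  assumes r: "r \<noteq> 0" and t: "\<And>j. t $ j \<noteq> 0"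
  shows "transformed_density r (posterior_kernel f b \<theta> r \<beta>) (v, t)
    = (2 powr (1 - \<beta>) / \<bar>r\<bar>) ^ CARD('n) * sqrt ((2 * pi) ^ CARD('n + 'n))
      * (exp (- potential f b \<theta> r \<beta> (v, t))
         * multivariate_normal_density 0 (mat 1) (vec_concat v t))"
proof -
  let ?J = "\<lambda>j. \<bar>change_of_vars_det r (v $ j) (t $ j)\<bar>"
  let ?x = "(1 / 2 powr (1 / (2 * r))) *\<^sub>R (diag_sqrt \<theta> *v vec_abs_powr_mult v t (1 / r))"
  let ?M = "- (1/2) * (norm (b - f ?x))\<^sup>2"
  let ?V = "- (1/2) * (\<Sum>j\<in>UNIV. (v $ j)\<^sup>2)" and ?T = "- (1/2) * (\<Sum>j\<in>UNIV. (t $ j)\<^sup>2)"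
  let ?L = "\<Sum>j\<in>UNIV. ln (lambda_of r (t $ j))" and ?A = "\<Sum>j\<in>UNIV. ln \<bar>t $ j\<bar>"
  have "(\<chi> j. xi_of r (v $ j) (t $ j))
      = (1 / 2 powr (1 / (2 * r))) *\<^sub>R vec_abs_powr_mult v t (1 / r)"
    using t by (simp add: vec_eq_iff vec_abs_powr_mult_def xi_of_eq)
  then have x: "diag_sqrt \<theta> *v (\<chi> j. xi_of r (v $ j) (t $ j)) = ?x"
    by (simp only: matrix_vector_mult_scaleR)
  have "posterior_kernel f b \<theta> r \<beta>
          (\<chi> j. xi_of r (v $ j) (t $ j), \<chi> j. lambda_of r (t $ j))
      = exp (?M + ?V + ?T + (r * \<beta> - 3/2) * ?L)"
    unfolding posterior_kernel_def prod.case x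
    using r t by (simp add: xi_of_square_div_lambda_of lambda_of_powr flip: sum_divide_distrib)
  then have "transformed_density r (posterior_kernel f b \<theta> r \<beta>) (v, t)
      = exp (?M + ?V + ?T) * ((\<Prod>j\<in>UNIV. ?J j) * exp ((r * \<beta> - 3/2) * ?L))"
    by (simp add: transformed_density_def exp_add)
  also have "(\<Prod>j\<in>UNIV. ?J j) * exp ((r * \<beta> - 3/2) * ?L)
      = (\<Prod>j\<in>UNIV. ?J j * exp ((r * \<beta> - 3/2) * ln (lambda_of r (t $ j))))"
    by (simp add: prod.distrib sum_distrib_left exp_sum)
  also have "\<dots> = (2 powr (1 - \<beta>) / \<bar>r\<bar>) ^ CARD('n) * exp ((2 * \<beta> - 1) * ?A)"
    using r t by (simp add: log_weight_eq prod.distrib sum_distrib_left exp_sum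
        prod_dividef power_divide)
  also have "exp (?M + ?V + ?T) * \<dots> = (2 powr (1 - \<beta>) / \<bar>r\<bar>) ^ CARD('n)
      * (exp (- potential f b \<theta> r \<beta> (v, t)) * exp (?V + ?T))"
    by (simp add: potential_def algebra_simps flip: exp_add)
  also have "exp (?V + ?T) = sqrt ((2 * pi) ^ CARD('n + 'n))
      * multivariate_normal_density 0 (mat 1) (vec_concat v t)"
    by (simp add: standard_normal_density_vec_concat)
  finally show ?thesis by (simp only: mult_ac)
qed

theorem mainTheorem1:
  fixes b :: "real^'m" and f :: "real^'n \<Rightarrow> real^'m" and r \<beta> :: real
    and \<theta> :: "real^'n" and posterior :: "(real^'n) \<times> (real^'n) \<Rightarrow> real"
  assumes "r \<noteq> 0" and "\<beta> > 0" and "\<And>j. \<theta> $ j > 0"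
    and "proportional_on (UNIV \<times> {l. \<forall>j. l $ j > 0}) posterior (posterior_kernel f b \<theta> r \<beta>)"
  shows "(\<forall>v t. t \<noteq> 0 \<longrightarrow> xi_of r v t = v * \<bar>t\<bar> powr (1 / r) / 2 powr (1 / (2 * r)))
    \<and> proportional_on (UNIV \<times> {t. \<forall>j. t $ j \<noteq> 0})
        (transformed_density r posterior)
        (\<lambda>(v, t). exp (- potential f b \<theta> r \<beta> (v, t))
                    * multivariate_normal_density 0 (mat 1) (vec_concat v t))"
proof (intro conjI allI impI)
  fix v t :: real
  assume "t \<noteq> 0"
  then show "xi_of r v t = v * \<bar>t\<bar> powr (1 / r) / 2 powr (1 / (2 * r))"
    by (rule xi_of_eq)
next
  obtain c where c: "c > 0"
    and post: "\<And>\<xi> l. (\<And>j. l $ j > 0) \<Longrightarrow> posterior (\<xi>, l) = c * posterior_kernel f b \<theta> r \<beta> (\<xi>, l)"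
    using assms(4) unfolding proportional_on_def by auto
  let ?K = "(2 powr (1 - \<beta>) / \<bar>r\<bar>) ^ CARD('n) * sqrt ((2 * pi) ^ CARD('n + 'n))"
  have "transformed_density r posterior (v, t)
      = (c * ?K) * (exp (- potential f b \<theta> r \<beta> (v, t))
          * multivariate_normal_density 0 (mat 1) (vec_concat v t))"
    if t: "\<And>j. t $ j \<noteq> 0" for v t :: "real^'n"
  proof -
    have "transformed_density r posterior (v, t)
        = c * transformed_density r (posterior_kernel f b \<theta> r \<beta>) (v, t)"
      by (simp add: transformed_density_def post lambda_of_pos[OF t])
    then show ?thesis
      by (simp only: transformed_posterior_kernel[OF assms(1) t] mult.assoc)
  qed
  moreover have "c * ?K > 0"
    using c assms(1) by (intro mult_pos_pos zero_less_power real_sqrt_gt_zero divide_pos_pos) simp_all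
  ultimately show "proportional_on (UNIV \<times> {t. \<forall>j. t $ j \<noteq> 0})
        (transformed_density r posterior)
        (\<lambda>(v, t). exp (- potential f b \<theta> r \<beta> (v, t))
                    * multivariate_normal_density 0 (mat 1) (vec_concat v t))"
    unfolding proportional_on_def by (intro exI[of _ "c * ?K"]) auto
qed

end
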